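(* The longest overlap-free word over the ternary alphabet $\{0,1,2\}$ whose curling-number transform is overlap-free has length $84$. That is, there exists an overlap-free ternary word $x$ of length $84$ with $C(x)$ overlap-free, and there is no such word of length greater than $84$.
   Context: Words are indexed from $0$: a finite word of length $n$ is $x = x[0]x[1]\cdots x[n-1]$, and $x[i..j]$ denotes the factor (contiguous block) $x[i]\cdots x[j]$. An overlap is a word of the form $a x a x a$ with $a$ a single letter and $x$ a possibly empty word; a word is overlap-free if it contains no overlap as a factor. The curling number of a nonempty finite word $u$ is the largest integer $k \ge 1$ such that $u = y z^k$ for some (possibly empty) word $y$ and some nonempty word $z$. For a finite or infinite word $x$, the curling-number transform $C(x)$ is the word over the positive integers, of the same length as $x$, whose $i$-th letter $C(x)[i]$ is the curling number of the prefix $x[0..i]$. *)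

theory Defs
  imports Main "HOL-Library.Sublist"
begin

definition overlap :: "'a list \<Rightarrow> bool" where
  "overlap w \<longleftrightarrow> (\<exists>a x. w = [a] @ x @ [a] @ x @ [a])"

definition overlap_free :: "'a list \<Rightarrow> bool" where
  "overlap_free w \<longleftrightarrow> \<not> (\<exists>v. sublist v w \<and> overlap v)"

definition word_power :: "'a list \<Rightarrow> nat \<Rightarrow> 'a list" where
  "word_power z k = concat (replicate k z)"

(* Only meaningful for nonempty u: no k satisfies the predicate when u = []. *)
definition curling_number :: "'a list \<Rightarrow> nat" where
  "curling_number u =
     (GREATEST k. k \<ge> 1 \<and> (\<exists>y z. z \<noteq> [] \<and> u = y @ word_power z k))"

(* The prefix x[0..i] has i + 1 letters. *)
definition curling_transform :: "'a list \<Rightarrow> nat list" where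
  "curling_transform x = map (\<lambda>i. curling_number (take (Suc i) x)) [0..<length x]"

(* The maximum defining the curling number of a nonempty word exists. *)
lemma curling_number_greatest:
  assumes "u \<noteq> []"
  shows "curling_number u \<ge> 1"
    and "\<exists>y z. z \<noteq> [] \<and> u = y @ word_power z (curling_number u)"
    and "\<And>k y z. \<lbrakk>k \<ge> 1; z \<noteq> []; u = y @ word_power z k\<rbrakk> \<Longrightarrow> k \<le> curling_number u"
proof -
  let ?P = "\<lambda>k. k \<ge> 1 \<and> (\<exists>y z. z \<noteq> [] \<and> u = y @ word_power z k)"
  have one: "?P 1"
    using assms by (auto simp: word_power_def intro: exI[of _ "[]"])
  have bound: "k \<le> length u" if k: "?P k" for k
  proof -
    obtain y z where z: "z \<noteq> []" and u: "u = y @ word_power z k" using k by blast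
    have "length (word_power z k) = k * length z"
      by (simp add: word_power_def length_concat sum_list_replicate)
    moreover have "k \<le> k * length z" using z by (cases z) auto
    ultimately show ?thesis using u by (metis length_append le_add2 order_trans)
  qed
  have "?P (curling_number u)"
    unfolding curling_number_def by (rule GreatestI_nat[of ?P 1 "length u"]) (use one bound in auto)
  then show "curling_number u \<ge> 1"
    and "\<exists>y z. z \<noteq> [] \<and> u = y @ word_power z (curling_number u)" by auto
  show "k \<le> curling_number u" if "k \<ge> 1" "z \<noteq> []" "u = y @ word_power z k" for k y z
    unfolding curling_number_def
    by (rule Greatest_le_nat[of ?P k "length u"]) (use that bound in auto)
qed

end

theory Submission
  imports Defs
begin

text \<open>
  An overlap-free word contains no cube, so its curling numbers are 1 or 2, and the value at a
  position is 2 iff a square ends there. Hence the transform is a binary word that can be computed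
  letter by letter, and words satisfying both conditions are closed under prefixes. The upper bound
  is a backtracking search over the words beginning with \<open>01\<close> or \<open>001\<close> (which suffices up to renaming
  letters), with about 175000 nodes, carried out by rewriting.

  Only squares of period at most 14 are recognised at each node. That no longer square occurs is
  checked at the lengths divisible by 6: a square of period \<open>p > 14\<close> that ends at most 6 letters
  later leaves a repetition at distance \<open>p\<close> of length at least \<open>p - 6\<close>, and none is ever found.
\<close>

section \<open>Repetitions at the front of reversed words\<close>

fun agree :: "nat \<Rightarrow> 'a list \<Rightarrow> 'a list \<Rightarrow> bool" where
  "agree 0 u v = True"
| "agree (Suc k) (a # u) (b # v) = (a = b \<and> agree k u v)"
| "agree (Suc k) _ _ = False"

lemma agree_iff: "agree k u v \<longleftrightarrow> k \<le> length u \<and> k \<le> length v \<and> take k u = take k v"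
  by (induction k u v rule: agree.induct) auto

text \<open>
  Words are stored reversed, so that prefixes of lists are suffixes of words. An entry 0 in the
  list of lengths means that the corresponding shift is not tested.
\<close>

fun repeats :: "nat list \<Rightarrow> 'a list \<Rightarrow> 'a list \<Rightarrow> bool" where
  "repeats [] w v = False"
| "repeats (k # ks) w v = (0 < k \<and> agree k w v \<or> repeats ks w (tl v))"

lemma repeats_iff:
  "repeats ks w v \<longleftrightarrow> (\<exists>i < length ks. 0 < ks ! i \<and> agree (ks ! i) w (drop i v))"
proof (induction ks arbitrary: v)
  case (Cons k ks)
  then show ?case
    by (simp add: Ex_less_Suc2 drop_Suc flip: drop_Suc)
qed simp

lemma not_repeats_Nil: "\<not> repeats ks w []"
proof (induction ks)
  case (Cons k ks)
  then show ?case by (cases k; cases w) auto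
qed simp

section \<open>Overlap-freeness under reversal, renaming and extension\<close>

lemma overlap_rev: "overlap (rev v) \<longleftrightarrow> overlap v"
proof -
  have "overlap (rev v)" if "overlap v" for v :: "'a list"
  proof -
    obtain a x where "v = [a] @ x @ [a] @ x @ [a]" using \<open>overlap v\<close> unfolding overlap_def by blast
    then have "rev v = [a] @ rev x @ [a] @ rev x @ [a]" by simp
    then show ?thesis unfolding overlap_def by blast
  qed
  from this[of v] this[of "rev v"] show ?thesis by auto
qed

lemma overlap_free_rev: "overlap_free (rev w) \<longleftrightarrow> overlap_free w"
proof -
  have "overlap_free (rev w)" if "overlap_free w" for w :: "'a list"
    using that unfolding overlap_free_def by (metis overlap_rev rev_rev_ident sublist_rev)
  from this[of w] this[of "rev w"] show ?thesis by auto
qed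

lemma overlap_free_sublist: "overlap_free w \<Longrightarrow> sublist v w \<Longrightarrow> overlap_free v"
  unfolding overlap_free_def by (meson sublist_order.order.trans)

lemma overlap_map: "overlap v \<Longrightarrow> overlap (map f v)"
  unfolding overlap_def by force

text \<open>Every map carries overlaps to overlaps; injectivity on the letters of \<open>w\<close>
  supplies an inverse map for the other direction.\<close>

lemma overlap_free_map:
  assumes "inj_on f (set w)"
  shows "overlap_free (map f w) \<longleftrightarrow> overlap_free w"
proof -
  have 1: "overlap_free w" if "overlap_free (map f w)" for f :: "'c \<Rightarrow> 'd" and w
    using that unfolding overlap_free_def by (metis overlap_map map_mono_sublist)
  have "map (inv_into (set w) f) (map f w) = w"
    using assms by (simp add: map_idI)
  then show ?thesis using 1[of "inv_into (set w) f" "map f w"] 1[of f w] by auto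
qed

text \<open>With \<open>p\<close> the length of \<open>ax\<close>, the word \<open>axaxa\<close> is
  exactly a word of length \<open>2 * p + 1\<close> with period \<open>p\<close>: its first
  \<open>p + 1\<close> letters recur at distance \<open>p\<close>.\<close>

lemma overlap_prefix_iff:
  "(\<exists>v. prefix v w \<and> overlap v) \<longleftrightarrow> (\<exists>p \<ge> 1. agree (Suc p) w (drop p w))"
proof
  assume "\<exists>v. prefix v w \<and> overlap v"
  then obtain a x r where w: "w = ([a] @ x @ [a] @ x @ [a]) @ r"
    unfolding overlap_def prefix_def by blast
  have "agree (Suc (Suc (length x))) w (drop (Suc (length x)) w)"
    by (simp add: agree_iff w)
  then show "\<exists>p \<ge> 1. agree (Suc p) w (drop p w)" by (intro exI[of _ "Suc (length x)"]) simp
next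
  assume "\<exists>p \<ge> 1. agree (Suc p) w (drop p w)"
  then obtain p where "p \<ge> 1" and p: "agree (Suc p) w (drop p w)" by blast
  obtain q where q: "p = Suc q" using \<open>p \<ge> 1\<close> by (cases p) auto
  have len: "2 * p < length w" and eq: "take (Suc p) w = take (Suc p) (drop p w)"
    using p by (auto simp: agree_iff)
  obtain a t where w: "w = a # t" using len by (cases w) auto
  define x where "x = take q t"
  have z: "take p w = a # x" by (simp add: w x_def q)
  have z2: "take p (drop p w) = a # x"
    using arg_cong[OF eq, of "take p"] z by (simp add: min_def)
  \<comment> \<open>Positions 0 and \<open>p\<close> of the repeated block link the letters at 0,
    \<open>p\<close> and \<open>2 * p\<close>; the last of these closes the overlap.\<close>
  have "w ! 0 = w ! p"
    using arg_cong[OF eq, of "\<lambda>u. u ! 0"] len by simp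
  moreover have "w ! p = w ! (p + p)"
    using arg_cong[OF eq, of "\<lambda>u. u ! p"] len by simp
  ultimately have "drop (2 * p) w = a # drop (Suc (2 * p)) w"
    using len by (metis Cons_nth_drop_Suc mult_2 nth_Cons_0 w)
  then have "w = (a # x) @ (a # x) @ a # drop (Suc (2 * p)) w"
    using z z2 append_take_drop_id[of p w] append_take_drop_id[of p "drop p w"]
    by (simp add: mult_2)
  then have "w = ([a] @ x @ [a] @ x @ [a]) @ drop (Suc (2 * p)) w" by simp
  then show "\<exists>v. prefix v w \<and> overlap v" unfolding overlap_def prefix_def by blast
qed

lemma overlap_free_Cons:
  "overlap_free (a # w) \<longleftrightarrow>
     overlap_free w \<and> \<not> (\<exists>p \<ge> 1. agree (Suc p) (a # w) (drop p (a # w)))"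
  unfolding overlap_free_def overlap_prefix_iff[symmetric] sublist_Cons_right by blast

lemma overlap_free_Nil: "overlap_free []"
  unfolding overlap_free_def overlap_def by simp

section \<open>Squares and curling numbers of overlap-free words\<close>

definition square_at :: "'a list \<Rightarrow> bool" where
  "square_at w \<longleftrightarrow> (\<exists>p \<ge> 1. agree p w (drop p w))"

lemma square_at_rev_iff: "square_at (rev x) \<longleftrightarrow> (\<exists>y z. z \<noteq> [] \<and> x = y @ z @ z)"
proof
  assume "square_at (rev x)"
  then obtain p where p: "p \<ge> 1" "agree p (rev x) (drop p (rev x))"
    unfolding square_at_def by blast
  define z where "z = take p (rev x)"
  have "rev x = z @ z @ drop p (drop p (rev x))"
    using p append_take_drop_id[of p "rev x"] append_take_drop_id[of p "drop p (rev x)"]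
    by (auto simp: z_def agree_iff)
  then have "x = rev (drop p (drop p (rev x))) @ rev z @ rev z"
    by (metis append_assoc rev_append rev_rev_ident)
  moreover have "rev z \<noteq> []" using p by (auto simp: z_def agree_iff)
  ultimately show "\<exists>y z. z \<noteq> [] \<and> x = y @ z @ z" by blast
next
  assume "\<exists>y z. z \<noteq> [] \<and> x = y @ z @ z"
  then obtain y z where "z \<noteq> []" "x = y @ z @ z" by blast
  then show "square_at (rev x)"
    unfolding square_at_def by (intro exI[of _ "length z"]) (auto simp: agree_iff Suc_le_eq)
qed

lemma curling_number_overlap_free:
  assumes "overlap_free x" and "x \<noteq> []"
  shows "curling_number x = (if square_at (rev x) then 2 else 1)"
proof -
  let ?k = "curling_number x"
  note k = curling_number_greatest[OF \<open>x \<noteq> []\<close>]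
  obtain y z where z: "z \<noteq> []" and x: "x = y @ word_power z ?k" using k(2) by blast
  have "?k \<le> 2"
  proof (rule ccontr)
    assume "\<not> ?k \<le> 2"
    then obtain j where j: "?k = 3 + j" using le_Suc_ex[of 3 ?k] by auto
    obtain a t where t: "z = a # t" using z by (cases z) auto
    \<comment> \<open>A cube of \<open>a # t\<close> begins with the overlap
      \<open>atata\<close>.\<close>
    have "x = y @ ([a] @ t @ [a] @ t @ [a]) @ t @ word_power z j"
      by (subst x) (simp add: j t word_power_def numeral_3_eq_3)
    then have "sublist ([a] @ t @ [a] @ t @ [a]) x" unfolding sublist_def by blast
    then show False using \<open>overlap_free x\<close> unfolding overlap_free_def overlap_def by blast
  qed
  moreover have "square_at (rev x)" if "?k = 2"
    using x z that unfolding square_at_rev_iff by (auto simp: word_power_def numeral_2_eq_2)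
  moreover have "2 \<le> ?k" if sq: "square_at (rev x)"
  proof -
    obtain y z where "z \<noteq> []" "x = y @ z @ z" using sq unfolding square_at_rev_iff by blast
    then show ?thesis by (intro k(3)[of 2 z y]) (auto simp: word_power_def numeral_2_eq_2)
  qed
  moreover have "?k \<noteq> 0" using k(1) by linarith
  ultimately show ?thesis by (cases "square_at (rev x)") (auto dest: le_antisym)
qed

section \<open>The transform as a binary word\<close>

text \<open>One alphabet serves both the words searched and their transforms, so the same rewrite
  rules treat both. In a transform \<open>A\<close> stands for curling number 1 and \<open>B\<close>
  for 2.\<close>

datatype letter = A | B | C

primrec squares :: "'a list \<Rightarrow> letter list" where
  "squares [] = []"
| "squares (a # w) = (if square_at (a # w) then B else A) # squares w"

lemma curling_transform_snoc:
  "curling_transform (x @ [a]) = curling_transform x @ [curling_number (x @ [a])]"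
  unfolding curling_transform_def by simp

lemma curling_transform_overlap_free:
  assumes "overlap_free x"
  shows "rev (curling_transform x) =
    map (\<lambda>b. if b = B then 2 else 1) (squares (rev x))"
  using assms
proof (induction x rule: rev_induct)
  case Nil
  then show ?case by (simp add: curling_transform_def)
next
  case (snoc a x)
  then have "overlap_free x" using overlap_free_sublist by fastforce
  with snoc show ?case
    by (simp add: curling_transform_snoc curling_number_overlap_free)
qed

lemma set_squares: "set (squares w) \<subseteq> {A, B}"
  by (induction w) auto

definition good :: "'a list \<Rightarrow> bool" where
  "good w \<longleftrightarrow> overlap_free w \<and> overlap_free (squares w)"

lemma good_rev_iff:
  "good (rev x) \<longleftrightarrow> overlap_free x \<and> overlap_free (curling_transform x)"
proof -
  \<comment> \<open>The relabelling is injective only on \<open>{A, B}\<close>, and \<open>C\<close>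
    never occurs in \<open>squares\<close>.\<close>
  have "inj_on (\<lambda>b. if b = B then 2 else 1 :: nat) (set (squares (rev x)))"
    by (rule inj_on_subset[OF _ set_squares]) (auto simp: inj_on_def)
  then show ?thesis
    unfolding good_def by (metis curling_transform_overlap_free overlap_free_map overlap_free_rev)
qed

lemma length_squares: "length (squares w) = length w"
  by (induction w) auto

text \<open>Dropping from a reversed word takes a prefix of the word, and each letter of the
  transform depends only on the prefix ending there.\<close>

lemma good_drop: "good w \<Longrightarrow> good (drop i w)"
proof -
  have "squares (drop i w) = drop i (squares w)"
    by (induction w arbitrary: i) (auto simp: drop_Cons split: nat.split)
  then show "good w \<Longrightarrow> good (drop i w)"
    unfolding good_def by (metis overlap_free_sublist sublist_drop)
qed

lemma agree_map:
  assumes "inj_on f (set u \<union> set v)"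
  shows "agree k (map f u) (map f v) \<longleftrightarrow> agree k u v"
  using assms by (induction k u v rule: agree.induct) (auto simp: inj_on_def)

lemma squares_map: "inj_on f (set w) \<Longrightarrow> squares (map f w) = squares w"
proof (induction w)
  case (Cons a w)
  have "inj_on f (set (a # w) \<union> set (drop p (a # w)))" for p
    by (rule inj_on_subset[OF Cons.prems]) (use set_drop_subset[of p "a # w"] in blast)
  then have "square_at (map f (a # w)) = square_at (a # w)"
    unfolding square_at_def drop_map by (simp only: agree_map)
  moreover have "squares (map f w) = squares w" using Cons by simp
  ultimately show ?case by simp
qed simp

lemma good_map: "inj_on f (set w) \<Longrightarrow> good (map f w) \<longleftrightarrow> good w"
  by (simp add: good_def overlap_free_map squares_map)

section \<open>The bounded search and its soundness\<close>

text \<open>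
  The lists \<open>sq\<close>, \<open>ov\<close>, \<open>cu\<close> and \<open>lg\<close> give the lengths tested for squares and overlaps in the word,
  for overlaps in its transform \<open>c\<close>, and for traces of long squares. One flag is consumed for each
  letter appended; running out of flags, or finding a trace of a long square, counts as failure.
\<close>

primrec exhausted ::
  "nat list \<Rightarrow> nat list \<Rightarrow> nat list \<Rightarrow> nat list \<Rightarrow> bool list \<Rightarrow> letter list \<Rightarrow> letter list \<Rightarrow> bool"
where
  "exhausted sq ov cu lg [] w c = False"
| "exhausted sq ov cu lg (f # fs) w c =
    (\<not> (f \<and> repeats lg w (tl w)) \<and>
     (\<forall>a. let s = repeats sq (a # w) w; b = (if s then B else A) in
        s \<and> repeats ov (a # w) w \<or> repeats cu (b # c) c \<or>
        exhausted sq ov cu lg fs (a # w) (b # c)))"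

text \<open>In all four lists entry \<open>i\<close> belongs to the period \<open>p = i + 1\<close>,
  because a word is compared with its own tail. Squares need length \<open>p\<close>, overlaps
  \<open>p + 1\<close>, traces of long squares \<open>p - 6\<close>. Periods skipped in
  \<open>ovs\<close> and \<open>cus\<close> only make the search prune less. The last period in
  \<open>lgs\<close> is 42, the largest that a square in a word of length at most 85 can
  have.\<close>

definition sqs :: "nat list" where "sqs = [1..<15]"
definition ovs :: "nat list" where "ovs = [2,3,4,5,6,7,8,0,0,0,0,13]"
definition cus :: "nat list" where "cus = [2,3,4,5,0,7,0,9,0,0,0,13,0,0,0,17,0,0,0,0,0,0,0,25]"
definition lgs :: "nat list" where "lgs = map (\<lambda>i. if i < 14 then 0 else i - 5) [0..<42]"

text \<open>The flag for \<open>t\<close> is consumed when a word of length \<open>t\<close> is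
  extended. None is left at length 85, so a branch reaching that length makes the search
  fail.\<close>

definition checks :: "nat \<Rightarrow> bool list" where
  "checks n = map (\<lambda>t. t mod 6 = 0) [n..<85]"

lemma repeats_overlap:
  assumes ks: "\<forall>i < length ks. ks ! i = 0 \<or> ks ! i = i + 2" and "repeats ks (a # w) w"
  shows "\<not> overlap_free (a # w)"
proof -
  obtain i where i: "i < length ks" "0 < ks ! i" "agree (ks ! i) (a # w) (drop i w)"
    using assms(2) unfolding repeats_iff by blast
  then have "ks ! i = Suc (Suc i)" using ks by auto
  with i(3) have "agree (Suc (Suc i)) (a # w) (drop (Suc i) (a # w))" by simp
  then show ?thesis unfolding overlap_free_Cons by force
qed

lemma repeats_square:
  assumes "\<forall>i < length ks. ks ! i = Suc i"
  shows "repeats ks (a # w) w \<longleftrightarrow> (\<exists>p. 1 \<le> p \<and> p \<le> length ks \<and> agree p (a # w) (drop p (a # w)))"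
proof -
  have "repeats ks (a # w) w \<longleftrightarrow>
      (\<exists>i < length ks. agree (Suc i) (a # w) (drop (Suc i) (a # w)))"
    unfolding repeats_iff using assms by fastforce
  then show ?thesis by (metis One_nat_def Suc_le_D Suc_le_eq le_numeral_extra(4) le_SucI Suc_le_mono zero_le)
qed

lemma agree_drop: "agree k u v \<Longrightarrow> agree (k - d) (drop d u) (drop d v)"
  unfolding agree_iff by (cases "d \<le> k") (auto simp: take_drop)

lemma agree_mono: "agree k u v \<Longrightarrow> j \<le> k \<Longrightarrow> agree j u v"
  unfolding agree_iff by (metis min.absorb1 order_trans take_take)

lemma agree_length: "agree k u v \<Longrightarrow> k \<le> length v"
  unfolding agree_iff by blast

text \<open>No suffix of a good word is pruned. Following the letters of \<open>W\<close> outward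
  from \<open>v\<close>, both overlap alternatives are false at each step, so exhaustion is
  inherited by the next longer suffix. The assumption on \<open>sq\<close> keeps the computed
  transform equal to \<open>squares\<close>.\<close>

lemma exhausted_descend:
  assumes sq: "\<And>a w. \<lbrakk>suffix (a # w) W; length (a # w) > length v\<rbrakk> \<Longrightarrow>
      repeats sq (a # w) w \<longleftrightarrow> square_at (a # w)"
    and ov: "\<forall>i < length ov. ov ! i = 0 \<or> ov ! i = i + 2"
    and cu: "\<forall>i < length cu. cu ! i = 0 \<or> cu ! i = i + 2"
    and good: "good W"
  shows "suffix v W \<Longrightarrow> exhausted sq ov cu lg fs v (squares v) \<Longrightarrow> length W - length v \<le> length fs \<Longrightarrow>
     exhausted sq ov cu lg (drop (length W - length v) fs) W (squares W)"
  using sq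
proof (induction fs arbitrary: v)
  case (Cons f fs)
  show ?case
  proof (cases "v = W")
    case False
    then obtain u where u: "W = u @ v" "u \<noteq> []" using Cons.prems(1) unfolding suffix_def by auto
    then obtain us a where us: "u = us @ [a]" by (metis rev_exhaust)
    let ?v = "a # v"
    have suf: "suffix ?v W" using u us unfolding suffix_def by auto
    then have g: "good ?v" using good unfolding suffix_def by (metis append_eq_conv_conj good_drop)
    have s: "repeats sq ?v v \<longleftrightarrow> square_at ?v" using Cons.prems(4)[of a v] suf by simp
    have "exhausted sq ov cu lg fs ?v (squares ?v)"
      using Cons.prems(2) g s repeats_overlap[OF ov, of a v]
         repeats_overlap[OF cu, of "if square_at ?v then B else A" "squares v"]
      unfolding good_def by (auto simp: Let_def split: if_splits)
    moreover have len: "length W - length v = Suc (length W - length ?v)" using u us by simp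
    ultimately show ?thesis using Cons.IH[of ?v] Cons.prems(3,4) suf by simp
  qed (use Cons.prems in simp)
qed (auto simp: suffix_def)


text \<open>If the bounded square test is correct all the way, exhaustion descends to
  \<open>W\<close>, where the flags have run out. Otherwise the shortest suffix on which it errs
  begins with a square of period above 14, and a slightly shorter suffix, where the test has been
  correct so far, shows its trace at a checked length.\<close>

lemma exhausted_good_length:
  assumes good: "good W" and len: "length W = 85" and v: "suffix v W" "length v \<le> 24"
    and ex: "exhausted sqs ovs cus lgs (checks (length v)) v (squares v)"
  shows False
proof -
  have ov: "\<forall>i < length ovs. ovs ! i = 0 \<or> ovs ! i = i + 2"
    by (simp add: ovs_def All_less_Suc2 numeral_eq_Suc)
  have cu: "\<forall>i < length cus. cus ! i = 0 \<or> cus ! i = i + 2"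
    by (simp add: cus_def All_less_Suc2 numeral_eq_Suc)
  have sq: "\<forall>i < length sqs. sqs ! i = Suc i" "length sqs = 14"
    by (auto simp: sqs_def)
  have drop_checks: "drop (t - length v) (checks (length v)) = checks t" if "length v \<le> t" for t
    using that by (simp add: checks_def drop_map)
  let ?bad = "\<lambda>u. suffix u W \<and> length v < length u \<and> u \<noteq> [] \<and> (repeats sqs u (tl u) \<noteq> square_at u)"
  show False
  proof (cases "\<exists>u. ?bad u")
    case False
    then have "repeats sqs (a # w) w = square_at (a # w)"
      if "suffix (a # w) W" "length v < length (a # w)" for a w
      using that by (metis list.distinct(1) list.sel(3))
    from exhausted_descend[OF this ov cu good v(1) ex]
    show False using len drop_checks[of 85] v(2) by (simp add: checks_def)
  next
    case True
    then obtain u where u: "?bad u" and min: "\<And>u'. ?bad u' \<Longrightarrow> length u \<le> length u'"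
      using ex_has_least_nat[of ?bad _ length] by metis
    obtain a w where aw: "u = a # w" using u by (cases u) auto
    from u obtain p where p: "1 \<le> p" "agree p u (drop p u)" "\<not> p \<le> 14"
      unfolding aw list.sel repeats_square[OF sq(1)] square_at_def sq(2) by blast
    have "length u \<le> 85" using u len suffix_length_le by metis
    moreover have "2 * p \<le> length u" using agree_length[OF p(2)] p(3) by simp
    ultimately have n: "2 * p \<le> length u" "length u \<le> 85" by simp_all
    \<comment> \<open>Removing \<open>d\<close> letters reaches the nearest smaller multiple of 6.
      As \<open>d\<close> is at least 1, the result is strictly shorter than \<open>u\<close> and
      minimality applies to its suffixes.\<close>
    define d where "d = Suc ((length u - 1) mod 6)"
    have d: "1 \<le> d" "d \<le> 6" "(length u - d) mod 6 = 0"
    proof -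
      have "(length u - 1) mod 6 < 6" by simp
      then show "1 \<le> d" "d \<le> 6" unfolding d_def by linarith+
      have "length u - d = (length u - 1) - (length u - 1) mod 6" unfolding d_def by simp
      then show "(length u - d) mod 6 = 0" by (simp add: minus_mod_eq_mult_div)
    qed
    define v' where "v' = drop d u"
    have lv': "length v' = length u - d" by (simp add: v'_def)
    have suf': "suffix v' W"
      using u unfolding v'_def by (meson suffix_drop suffix_order.trans)
    \<comment> \<open>Since \<open>p\<close> is at least 15 and \<open>d\<close> at most 6,
      \<open>v'\<close> has length at least 24; this is where the bound on \<open>v\<close>
      enters.\<close>
    have vv': "suffix v v'"
      using suffix_length_suffix[OF v(1) suf'] v(2) lv' n p(3) d(2) by linarith
    have good': "good v'" using suf' good unfolding suffix_def by (metis append_eq_conv_conj good_drop)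
    have "repeats sqs (a # w) w = square_at (a # w)"
      if "suffix (a # w) v'" "length v < length (a # w)" for a w
    proof -
      have "suffix (a # w) W" using that(1) suf' suffix_order.trans by blast
      moreover have "length (a # w) < length u"
        using suffix_length_le[OF that(1)] lv' d(1) n p(3) by linarith
      ultimately show ?thesis using min[of "a # w"] that(2) by force
    qed
    from exhausted_descend[OF this ov cu good' vv' ex]
    have "exhausted sqs ovs cus lgs (checks (length v')) v' (squares v')"
      using drop_checks[of "length v'"] suffix_length_le[OF vv'] lv' n(2)
      by (simp add: checks_def)
    moreover have "checks (length v') = True # checks (Suc (length v'))"
      unfolding checks_def using lv' d n p(3) by (subst upt_rec) auto
    ultimately have "\<not> repeats lgs v' (tl v')" by simp
    moreover have "repeats lgs v' (tl v')"
    proof -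
      have "agree (p - d) v' (drop p v')"
        using agree_drop[OF p(2), of d] unfolding v'_def by (simp add: add.commute)
      then have "agree (p - 6) v' (drop p v')" by (rule agree_mono) (use d(2) in simp)
      moreover have "lgs ! (p - 1) = p - 6" "p - 1 < length lgs"
        using p(3) n by (auto simp: lgs_def)
      moreover have "drop (p - 1) (tl v') = drop p v'" using p(1) by (cases p) (auto simp: drop_Suc)
      ultimately show ?thesis unfolding repeats_iff using p(3) by (intro exI[of _ "p - 1"]) simp
    qed
    ultimately show False by blast
  qed
qed

section \<open>Verification of a word of length 84\<close>

text \<open>A square in a word of at most \<open>2 * n\<close> letters has period at most
  \<open>n\<close>, so the unbounded search for a period becomes a finite, executable test.\<close>

lemma square_at_code:
  assumes "length w < 2 * n"
  shows "square_at (a # w) \<longleftrightarrow> repeats [1..<Suc n] (a # w) w"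
proof -
  have "p \<le> n" if "agree p (a # w) (drop p (a # w))" for p
    using agree_length[OF that] assms by (cases p) auto
  then show ?thesis by (subst repeats_square) (force simp: square_at_def simp del: upt_Suc)+
qed

lemma overlap_free_code:
  assumes "length w < 2 * n"
  shows "overlap_free (a # w) \<longleftrightarrow> overlap_free w \<and> \<not> repeats [2..<Suc (Suc n)] (a # w) w"
proof -
  have "p \<le> n" if "agree (Suc p) (a # w) (drop p (a # w))" for p
    using agree_length[OF that] assms by (cases p) auto
  then have "(\<exists>p \<ge> 1. agree (Suc p) (a # w) (drop p (a # w))) \<longleftrightarrow>
      (\<exists>i < n. agree (Suc (Suc i)) (a # w) (drop (Suc i) (a # w)))"
    by (metis One_nat_def Suc_le_D Suc_le_eq le_add1 plus_1_eq_Suc)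
  then show ?thesis unfolding overlap_free_Cons repeats_iff by (auto simp del: upt_Suc)
qed

primrec squares_code :: "nat list \<Rightarrow> 'a list \<Rightarrow> letter list" where
  "squares_code ks [] = []"
| "squares_code ks (a # w) = (if repeats ks (a # w) w then B else A) # squares_code ks w"

primrec check_overlap_free :: "nat list \<Rightarrow> 'a list \<Rightarrow> bool" where
  "check_overlap_free ks [] = True"
| "check_overlap_free ks (a # w) = (check_overlap_free ks w \<and> \<not> repeats ks (a # w) w)"

lemma squares_code: "length w \<le> 2 * n \<Longrightarrow> squares_code [1..<Suc n] w = squares w"
  by (induction w) (auto simp: square_at_code[of _ n] simp del: upt_Suc)

lemma check_overlap_free: "length w \<le> 2 * n \<Longrightarrow> check_overlap_free [2..<Suc (Suc n)] w = overlap_free w"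
  by (induction w) (auto simp: overlap_free_code[of _ n] overlap_free_Nil simp del: upt_Suc)

lemma good_code:
  "length w \<le> 2 * n \<Longrightarrow> check_overlap_free [2..<Suc (Suc n)] w \<Longrightarrow>
   check_overlap_free [2..<Suc (Suc n)] (squares_code [1..<Suc n] w) \<Longrightarrow> good w"
  unfolding good_def by (metis check_overlap_free length_squares squares_code)

text \<open>The witness, stored last letter first.\<close>

definition longest :: "letter list" where
  "longest = [A,A,B,B,C,A,C,C,B,B,A,C,C,B,B,C,A,A,B,C,A,A,C,A,A,B,B,C,B,C,A,C,A,A,C,A,B,B,A,B,B,C,A,C,A,A,C,A,B,A,A,B,A,B,B,C,A,A,B,C,A,A,C,A,A,B,B,C,B,C,A,C,A,A,C,A,B,A,A,B,A,B,B,A]"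

lemma length_longest: "length longest = 84"
  by (simp add: longest_def)

lemma good_longest: "good longest"
  by (rule good_code[of _ 42]; code_simp)


section \<open>Evaluation of the search by rewriting\<close>

text \<open>
  The simplifier evaluates innermost first and would explore both branches of a conditional. The
  constants below postpone a branch until the test in their first argument has been evaluated.
\<close>

definition scan where
  "scan a ks w v = repeats ks (a # w) v"

definition scan_rest where
  "scan_rest r a ks w v = (r \<or> scan a ks w v)"

definition child where
  "child sq ov cu lg fs a w c =
    (let s = repeats sq (a # w) w; b = (if s then B else A) in
        s \<and> repeats ov (a # w) w \<or> repeats cu (b # c) c \<or>
        exhausted sq ov cu lg fs (a # w) (b # c))"

definition child_square where
  "child_square s a sq ov cu lg fs w c =
    (let b = (if s then B else A) in
        s \<and> repeats ov (a # w) w \<or> repeats cu (b # c) c \<or>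
        exhausted sq ov cu lg fs (a # w) (b # c))"

definition child_overlap where
  "child_overlap r b sq ov cu lg fs w c =
    (r \<or> repeats cu (b # c) c \<or> exhausted sq ov cu lg fs w (b # c))"

definition child_curling where
  "child_curling r sq ov cu lg fs w c = (r \<or> exhausted sq ov cu lg fs w c)"

definition node where
  "node r sq ov cu lg fs w c = (\<not> r \<and> (\<forall>a. child sq ov cu lg fs a w c))"

definition node_BC where
  "node_BC r sq ov cu lg fs w c =
    (r \<and> child sq ov cu lg fs B w c \<and> child sq ov cu lg fs C w c)"

definition node_C where
  "node_C r sq ov cu lg fs w c = (r \<and> child sq ov cu lg fs C w c)"

lemma all_letter: "(\<forall>a. P a) \<longleftrightarrow> P A \<and> P B \<and> P C"
  by (metis letter.exhaust)

text \<open>Letters are compared by cases, so every rule is an unconditional rewrite. Only a child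
  with a square is tested for overlaps in the word, as an overlap at the front contains a square
  there.\<close>

lemma search_simps:
  "scan a [] w v = False"
  "scan a (k # ks) w [] = False"
  "scan a (0 # ks) w (y # v) = scan a ks w v"
  "scan A (Suc k # ks) w (A # v) = scan_rest (agree k w v) A ks w v"
  "scan B (Suc k # ks) w (B # v) = scan_rest (agree k w v) B ks w v"
  "scan C (Suc k # ks) w (C # v) = scan_rest (agree k w v) C ks w v"
  "scan A (Suc k # ks) w (B # v) = scan A ks w v"
  "scan A (Suc k # ks) w (C # v) = scan A ks w v"
  "scan B (Suc k # ks) w (A # v) = scan B ks w v"
  "scan B (Suc k # ks) w (C # v) = scan B ks w v"
  "scan C (Suc k # ks) w (A # v) = scan C ks w v"
  "scan C (Suc k # ks) w (B # v) = scan C ks w v"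
  "scan_rest True a ks w v = True"
  "scan_rest False a ks w v = scan a ks w v"
  "agree 0 u v = True"
  "agree (Suc k) [] v = False"
  "agree (Suc k) u [] = False"
  "agree (Suc k) (A # u) (A # v) = agree k u v"
  "agree (Suc k) (B # u) (B # v) = agree k u v"
  "agree (Suc k) (C # u) (C # v) = agree k u v"
  "agree (Suc k) (A # u) (B # v) = False"
  "agree (Suc k) (A # u) (C # v) = False"
  "agree (Suc k) (B # u) (A # v) = False"
  "agree (Suc k) (B # u) (C # v) = False"
  "agree (Suc k) (C # u) (A # v) = False"
  "agree (Suc k) (C # u) (B # v) = False"
  "exhausted sq ov cu lg [] w c = False"
  "exhausted sq ov cu lg (False # fs) w c = node_BC (child sq ov cu lg fs A w c) sq ov cu lg fs w c"
  "exhausted sq ov cu lg (True # fs) (x # w) c = node (scan x lg w w) sq ov cu lg fs (x # w) c"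
  "node True sq ov cu lg fs w c = False"
  "node False sq ov cu lg fs w c = node_BC (child sq ov cu lg fs A w c) sq ov cu lg fs w c"
  "node_BC False sq ov cu lg fs w c = False"
  "node_BC True sq ov cu lg fs w c = node_C (child sq ov cu lg fs B w c) sq ov cu lg fs w c"
  "node_C False sq ov cu lg fs w c = False"
  "node_C True sq ov cu lg fs w c = child sq ov cu lg fs C w c"
  "child sq ov cu lg fs a w c = child_square (scan a sq w w) a sq ov cu lg fs w c"
  "child_square True a sq ov cu lg fs w c = child_overlap (scan a ov w w) B sq ov cu lg fs (a # w) c"
  "child_square False a sq ov cu lg fs w c = child_curling (scan A cu c c) sq ov cu lg fs (a # w) (A # c)"
  "child_overlap True b sq ov cu lg fs w c = True"
  "child_overlap False b sq ov cu lg fs w c = child_curling (scan b cu c c) sq ov cu lg fs w (b # c)"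
  "child_curling True sq ov cu lg fs w c = True"
  "child_curling False sq ov cu lg fs w c = exhausted sq ov cu lg fs w c"
  by (auto simp: scan_def scan_rest_def not_repeats_Nil node_def node_BC_def node_C_def child_def
      child_square_def child_overlap_def child_curling_def all_letter Let_def)

lemmas search_setup = sqs_def ovs_def cus_def lgs_def checks_def upt_rec

lemma search_AB: "exhausted sqs ovs cus lgs (checks 2) [B, A] [A, A]"
  \<comment> \<open>The parameter lists are evaluated first with the search itself frozen, then
    numerals become successors to match the rules, and then the search runs.\<close>
  by (simp add: search_setup del: exhausted.simps repeats.simps agree.simps,
      simp only: One_nat_def eval_nat_numeral BitM.simps, simp only: search_simps)

lemma search_AAB: "exhausted sqs ovs cus lgs (checks 3) [B, A, A] [A, B, A]"
  by (simp add: search_setup del: exhausted.simps repeats.simps agree.simps,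
      simp only: One_nat_def eval_nat_numeral BitM.simps, simp only: search_simps)

section \<open>Canonical first letters and the theorem\<close>

text \<open>Name the first letter \<open>A\<close> and the first letter different from it
  \<open>B\<close>. The latter is among the first three letters, since \<open>aaa\<close> is an
  overlap.\<close>

lemma canonical_letters:
  fixes x :: "nat list"
  assumes "set x \<subseteq> {0, 1, 2}" and "overlap_free x" and "3 \<le> length x"
  obtains f :: "nat \<Rightarrow> letter" where "inj_on f (set x)"
    and "prefix [A, B] (map f x) \<or> prefix [A, A, B] (map f x)"
proof -
  obtain a y where "x = a # y" using assms(3) by (cases x) auto
  moreover obtain b z where "y = b # z" using assms(3) calculation by (cases y) auto
  moreover obtain c r where "z = c # r" using assms(3) calculation by (cases z) auto
  ultimately have x: "x = a # b # c # r" by simp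
  define e where "e = (if a = b then c else b)"
  have "a \<noteq> e"
  proof
    assume "a = e"
    then have "x = ([a] @ [] @ [a] @ [] @ [a]) @ r" unfolding x e_def by (auto split: if_splits)
    then have "overlap ([a] @ [] @ [a] @ [] @ [a])" "sublist ([a] @ [] @ [a] @ [] @ [a]) x"
      unfolding overlap_def sublist_def by blast+
    then show False using assms(2) unfolding overlap_free_def by blast
  qed
  define f where "f n = (if n = a then A else if n = e then B else C)" for n
  have le: "n \<le> 2" if "n \<in> set x" for n using assms(1) that by auto
  then have "a \<le> 2" "e \<le> 2" unfolding x e_def by (auto split: if_splits)
  \<comment> \<open>The three letters sum to 3, so only one value can be sent to
    \<open>C\<close>.\<close>
  then have "n = 3 - a - e" if "n \<in> set x" "n \<noteq> a" "n \<noteq> e" for n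
    using le[OF that(1)] that(2,3) \<open>a \<noteq> e\<close> by linarith
  then have "inj_on f (set x)"
    by (intro inj_onI) (metis f_def letter.distinct)
  moreover have "prefix [A, B] (map f x) \<or> prefix [A, A, B] (map f x)"
    using \<open>a \<noteq> e\<close> unfolding x f_def e_def by auto
  ultimately show ?thesis using that by blast
qed

theorem theorem7:
  shows "(\<exists>x :: nat list. set x \<subseteq> {0, 1, 2} \<and> length x = 84 \<and>
            overlap_free x \<and> overlap_free (curling_transform x))
       \<and> \<not> (\<exists>x :: nat list. set x \<subseteq> {0, 1, 2} \<and> length x > 84 \<and>
            overlap_free x \<and> overlap_free (curling_transform x))"
proof
  define g :: "letter \<Rightarrow> nat" where "g = case_letter 0 1 2"
  define x where "x = rev (map g longest)"
  have "inj g" unfolding inj_def g_def by (auto split: letter.splits)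
  then have "good (rev x)"
    unfolding x_def using good_longest by (simp add: good_map inj_on_subset)
  moreover have "set x \<subseteq> {0, 1, 2}" unfolding x_def g_def by (auto split: letter.splits)
  moreover have "length x = 84" by (simp add: x_def length_longest)
  ultimately show "\<exists>x :: nat list. set x \<subseteq> {0, 1, 2} \<and> length x = 84 \<and>
      overlap_free x \<and> overlap_free (curling_transform x)"
    using good_rev_iff by blast
next
  show "\<not> (\<exists>x :: nat list. set x \<subseteq> {0, 1, 2} \<and> length x > 84 \<and>
      overlap_free x \<and> overlap_free (curling_transform x))"
  proof
    assume "\<exists>x :: nat list. set x \<subseteq> {0, 1, 2} \<and> length x > 84 \<and>
      overlap_free x \<and> overlap_free (curling_transform x)"
    then obtain x :: "nat list" where x: "set x \<subseteq> {0, 1, 2}" "length x > 84" "good (rev x)"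
      using good_rev_iff by blast
    \<comment> \<open>Prefix closure reduces any longer word to length exactly 85, the depth of the
      search.\<close>
    define y where "y = take 85 x"
    have y: "set y \<subseteq> {0, 1, 2}" "length y = 85"
      using x(1,2) set_take_subset[of 85 x] unfolding y_def by auto
    have "good (rev y)" unfolding y_def using good_drop[OF x(3)] by (simp add: rev_take)
    then have "overlap_free y" unfolding good_rev_iff by blast
    then obtain f where f: "inj_on f (set y)"
        "prefix [A, B] (map f y) \<or> prefix [A, A, B] (map f y)"
      using canonical_letters[OF y(1)] y(2) by force
    define W where "W = rev (map f y)"
    have W: "good W" "length W = 85"
      using good_map[of f "rev y"] f(1) \<open>good (rev y)\<close> y(2) unfolding W_def by (simp_all add: rev_map)
    have "squares [B, A] = [A, A]" "squares [B, A, A] = [A, B, A]"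
      by (simp_all add: square_at_code[of _ 2] upt_rec)
    then have "exhausted sqs ovs cus lgs (checks (length v)) v (squares v)"
      if "v = [B, A] \<or> v = [B, A, A]" for v
      using that search_AB search_AAB by (auto simp flip: numeral_2_eq_2 numeral_3_eq_3)
    then have "\<not> suffix v W" if "v = [B, A] \<or> v = [B, A, A]" for v
      using exhausted_good_length[OF W] that by fastforce
    moreover have "suffix [B, A] W \<or> suffix [B, A, A] W"
      using f(2) unfolding W_def by (simp add: suffix_to_prefix)
    ultimately show False by blast
  qed
qed

end
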